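(* Let $k\ge1$ be an integer and $z$ an indeterminate. For every $n\ge 1$, in $\mathbb{Q}(z)$, $$n!\sum_{T\in T_k(n)}\prod_{h\in\mathcal{H}(T)}\frac{\big(z+(k-1)h\big)^{h-1}}{kh\big(kz+(k-1)(h-1)\big)^{h-2}}=z\big(z+(k-1)n\big)^{n-1}.$$
   Context: A $k$-ary tree is an ordered rooted unlabeled tree in which every vertex has exactly $k$ subtrees in linear order, where a subtree is allowed to be empty; $T_k(n)$ is the set of $k$-ary trees with $n$ vertices. For a vertex $u$ of a tree $T$, the hook length $h_u$ is the number of descendants of $u$ (counting $u$ itself), and $\mathcal{H}(T)$ is the multiset of hook lengths of the vertices of $T$; the product over $\mathcal{H}(T)$ is the product over all vertices. For $h=1$ the exponent $h-2=-1$ is a genuine negative power. *)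

theory Defs
  imports
    "HOL-Computational_Algebra.Polynomial"
    "HOL-Computational_Algebra.Fraction_Field"
    "HOL-Library.Multiset"
begin

text \<open>
  Vertices are the occurrences of \<open>Node\<close>, which carries the linearly ordered list of subtrees
  of the vertex; an absent subtree is \<open>Empty\<close> and contributes no vertex.
\<close>

datatype otree = Empty | Node "otree list"

fun is_kary :: "nat \<Rightarrow> otree \<Rightarrow> bool" where
  "is_kary k Empty \<longleftrightarrow> True"
| "is_kary k (Node ts) \<longleftrightarrow> length ts = k \<and> (\<forall>t\<in>set ts. is_kary k t)"

fun num_vertices :: "otree \<Rightarrow> nat" where
  "num_vertices Empty = 0"
| "num_vertices (Node ts) = 1 + (\<Sum>t\<leftarrow>ts. num_vertices t)"

definition kary_trees :: "nat \<Rightarrow> nat \<Rightarrow> otree set" where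
  "kary_trees k n = {T. is_kary k T \<and> num_vertices T = n}"

text \<open>
  The descendants of a vertex, itself included, are the vertices of the subtree rooted at it, so
  the hook length of the root of \<open>Node ts\<close> is \<open>num_vertices (Node ts)\<close>.
\<close>

fun hook_lengths :: "otree \<Rightarrow> nat multiset" where
  "hook_lengths Empty = {#}"
| "hook_lengths (Node ts) = add_mset (num_vertices (Node ts)) (\<Sum>t\<leftarrow>ts. hook_lengths t)"

text \<open>
  The field of rational functions over the rationals is the fraction field of the polynomial ring;
  \<open>ratfun_z\<close> is its indeterminate.
\<close>

type_synonym ratfun = "rat poly fract"

definition ratfun_z :: ratfun where
  "ratfun_z = Fract [:0, 1:] 1"

lemma size_hook_lengths: "size (hook_lengths T) = num_vertices T"
proof (induction T rule: hook_lengths.induct)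
  case (2 ts)
  have "size (\<Sum>t\<leftarrow>us. hook_lengths t) = (\<Sum>t\<leftarrow>us. num_vertices t)" if "set us \<subseteq> set ts" for us
    using that 2 by (induction us) auto
  then show ?case by simp
qed simp

lemma hook_lengths_pos: "h \<in># hook_lengths T \<Longrightarrow> h > 0"
proof (induction T rule: hook_lengths.induct)
  case (2 ts)
  have "h > 0" if "set us \<subseteq> set ts" "h \<in># (\<Sum>t\<leftarrow>us. hook_lengths t)" for us
    using that 2(1) by (induction us) auto
  then show ?case using 2(2) by auto
qed simp

text \<open>The sum over \<open>kary_trees k n\<close> is thus not the default value 0 of a sum over an infinite set.\<close>

lemma finite_kary_trees: "finite (kary_trees k n)"
proof (induction n rule: less_induct)
  case (less n)
  let ?A = "\<Union>m<n. kary_trees k m"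
  have "kary_trees k n \<subseteq> insert Empty (Node ` {ts. set ts \<subseteq> ?A \<and> length ts = k})"
  proof
    fix T assume T: "T \<in> kary_trees k n"
    show "T \<in> insert Empty (Node ` {ts. set ts \<subseteq> ?A \<and> length ts = k})"
    proof (cases T)
      case (Node ts)
      have "num_vertices t < n" if "t \<in> set ts" for t
        using T Node member_le_sum_list[of "num_vertices t" "map num_vertices ts"] that
        by (auto simp: kary_trees_def)
      then show ?thesis using T Node by (auto simp: kary_trees_def)
    qed simp
  qed
  moreover have "finite {ts. set ts \<subseteq> ?A \<and> length ts = k}"
    using less by (intro finite_lists_length_eq) auto
  ultimately show ?case by (meson finite.insertI finite_imageI finite_subset)
qed

end

theory Submission
  imports Defs "HOL-Computational_Algebra.Formal_Power_Series"
begin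

text \<open>
  Put \<open>m = k - 1\<close>. Abel's convolution identity says that the series
  \<open>\<Sum>n. z (z + m n)^(n - 1) / n! X^n\<close> is multiplicative in \<open>z\<close>, so its \<open>k\<close>-th power is the same
  series with \<open>k z\<close> for \<open>z\<close>. Removing the root of a tree shows that the generating function \<open>S\<close>
  of the weighted trees satisfies \<open>S\<^sub>n = g n [X^(n - 1)] S^k\<close>, where \<open>g n\<close> is the factor of the
  root, and the weight is chosen such that this recursion is the one of Abel's series. Abel's
  identity itself follows since both sides, as polynomials in one of the two variables, form
  sequences \<open>p\<^sub>n\<close> with \<open>p\<^sub>n\<^sub>+\<^sub>1' (x) = p\<^sub>n (x + m)\<close> that agree at \<open>0\<close>.
\<close>

unbundle fps_syntax

section \<open>Abel polynomials and their convolution identity\<close>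

text \<open>The case \<open>n = 0\<close> is separate because truncated subtraction turns the
  exponent \<open>n - 1\<close> into 0, so the general formula would give \<open>x\<close> instead
  of 1.\<close>

definition abel_poly :: "'a::field_char_0 \<Rightarrow> nat \<Rightarrow> 'a poly" where
  "abel_poly m n =
     (if n = 0 then 1 else smult (1 / fact n) ([:0, 1:] * [:m * of_nat n, 1:] ^ (n - 1)))"

lemma abel_poly_0 [simp]: "abel_poly m 0 = 1"
  by (simp add: abel_poly_def)

lemma poly_abel_poly:
  "n > 0 \<Longrightarrow> poly (abel_poly m n) x = x * (x + m * of_nat n) ^ (n - 1) / fact n"
  by (simp add: abel_poly_def poly_power add_ac)

lemma poly_abel_poly_at_0: "poly (abel_poly m n) 0 = (if n = 0 then 1 else 0)"
  by (simp add: poly_abel_poly)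

lemma pderiv_abel_poly: "pderiv (abel_poly m (Suc n)) = pcompose (abel_poly m n) [:m, 1:]"
proof (rule poly_ext)
  fix x
  show "poly (pderiv (abel_poly m (Suc n))) x = poly (pcompose (abel_poly m n) [:m, 1:]) x"
  proof (cases n)
    case 0
    then show ?thesis by (simp add: abel_poly_def pderiv_pCons pcompose_1)
  next
    case (Suc l)
    define u where "u = x + m * of_nat (Suc n)"
    have u: "m + x + m * of_nat n = u"
      by (simp add: u_def algebra_simps)
    define p where "p = [:m * of_nat (Suc n), 1:]"
    have p: "pderiv p = 1" "poly p x = u"
      by (simp_all add: p_def u_def pderiv_pCons add_ac)
    have "abel_poly m (Suc n) = smult (1 / fact (Suc n)) ([:0, 1:] * p ^ n)"
      by (simp add: abel_poly_def p_def)
    then have "poly (pderiv (abel_poly m (Suc n))) x = (u ^ n + x * (of_nat n * u ^ l)) / fact (Suc n)"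
      using pderiv_mult[of "[:0, 1:]" "p ^ n"]
      by (simp add: pderiv_smult pderiv_power pderiv_pCons[of 0] poly_power p Suc add_ac
          del: mult_pCons_left power_Suc fact_Suc of_nat_Suc)
    \<comment> \<open>With \<open>u ^ l\<close> factored out,
      \<open>u + n x = (n + 1) (x + m)\<close> remains, whose factor \<open>n + 1\<close> then
      cancels in \<open>fact (Suc n)\<close>.\<close>
    also have "u ^ n + x * (of_nat n * u ^ l) = of_nat (Suc n) * (m + x) * u ^ l"
      by (simp add: Suc u_def algebra_simps)
    also have "\<dots> / fact (Suc n) = (m + x) * u ^ l / fact n"
      by (simp del: of_nat_Suc)
    also have "\<dots> = poly (pcompose (abel_poly m n) [:m, 1:]) x"
      by (simp add: poly_pcompose poly_abel_poly Suc flip: u)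
    finally show ?thesis .
  qed
qed

lemma poly_eqI_pderiv:
  fixes p q :: "'a::{idom, ring_char_0} poly"
  assumes "pderiv p = pderiv q" "poly p 0 = poly q 0"
  shows "p = q"
proof -
  have "pderiv (p - q) = 0"
    using assms by (simp add: pderiv_diff)
  then obtain c where "p - q = [:c:]"
    using pderiv_iszero by blast
  moreover have "poly (p - q) 0 = 0"
    using assms by simp
  ultimately show ?thesis by simp
qed

text \<open>Abel's identity for fixed \<open>y\<close>, with the other variable as that of the
  polynomials. Differentiation lowers \<open>n\<close> and shifts by \<open>m\<close> on both sides,
  and the shifts by \<open>m\<close> and by \<open>y\<close> commute.\<close>

lemma abel_poly_shift:
  "(\<Sum>i\<le>n. smult (poly (abel_poly m (n - i)) y) (abel_poly m i)) = pcompose (abel_poly m n) [:y, 1:]"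
proof (induction n)
  case 0
  then show ?case by (simp add: pcompose_1)
next
  case (Suc n)
  let ?b = "\<lambda>i. poly (abel_poly m i) y"
  show ?case
  proof (rule poly_eqI_pderiv)
    have "pderiv (\<Sum>i\<le>Suc n. smult (?b (Suc n - i)) (abel_poly m i)) =
            (\<Sum>i\<le>n. smult (?b (n - i)) (pcompose (abel_poly m i) [:m, 1:]))"
      \<comment> \<open>The split-off summand for \<open>i = 0\<close> is constant, so its
        derivative vanishes.\<close>
      by (subst sum.atMost_Suc_shift)
        (simp add: pderiv_add pderiv_smult pderiv_abel_poly
          higher_pderiv_sum[of 1, simplified])
    also have "\<dots> = pcompose (\<Sum>i\<le>n. smult (?b (n - i)) (abel_poly m i)) [:m, 1:]"
      by (simp add: pcompose_sum pcompose_smult)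
    also have "\<dots> = pcompose (abel_poly m n) (pcompose [:y, 1:] [:m, 1:])"
      by (simp add: Suc pcompose_assoc)
    also have "pcompose [:y, 1:] [:m, 1:] = pcompose [:m, 1:] [:y, 1:]"
      by (simp add: pcompose_pCons add_ac)
    also have "pcompose (abel_poly m n) \<dots> = pderiv (pcompose (abel_poly m (Suc n)) [:y, 1:])"
      by (simp add: pderiv_pcompose pderiv_abel_poly pcompose_assoc pderiv_pCons)
    finally show "pderiv (\<Sum>i\<le>Suc n. smult (?b (Suc n - i)) (abel_poly m i)) =
                    pderiv (pcompose (abel_poly m (Suc n)) [:y, 1:])" .
    \<comment> \<open>At 0 only the summand for \<open>i = 0\<close> survives, and both sides are
      \<open>?b (Suc n)\<close>.\<close>
    show "poly (\<Sum>i\<le>Suc n. smult (?b (Suc n - i)) (abel_poly m i)) 0 =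
            poly (pcompose (abel_poly m (Suc n)) [:y, 1:]) 0"
      by (simp add: poly_sum poly_pcompose poly_abel_poly_at_0 if_distrib cong: if_cong)
  qed
qed

definition abel_fps :: "'a::field_char_0 \<Rightarrow> 'a \<Rightarrow> 'a fps" where
  "abel_fps m x = Abs_fps (\<lambda>n. poly (abel_poly m n) x)"

lemma abel_fps_nth [simp]: "abel_fps m x $ n = poly (abel_poly m n) x"
  by (simp add: abel_fps_def)

lemma abel_fps_add: "abel_fps m (x + y) = abel_fps m x * abel_fps m y"
proof (rule fps_ext)
  fix n
  have "poly (\<Sum>i\<le>n. smult (poly (abel_poly m (n - i)) y) (abel_poly m i)) x
          = poly (abel_poly m n) (x + y)"
    by (simp add: abel_poly_shift poly_pcompose add_ac)
  then show "abel_fps m (x + y) $ n = (abel_fps m x * abel_fps m y) $ n"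
    by (simp add: fps_mult_nth poly_sum atLeast0AtMost mult.commute)
qed

lemma abel_fps_power: "abel_fps m x ^ j = abel_fps m (of_nat j * x)"
proof (induction j)
  case 0
  show ?case by (rule fps_ext) (simp add: poly_abel_poly_at_0)
next
  case (Suc j)
  then show ?case by (simp add: abel_fps_add distrib_right)
qed

text \<open>Needed for the strong induction over trees, where only the lower coefficients of the
  generating function are known so far.\<close>

lemma fps_power_nth_cong:
  fixes F G :: "'a::comm_semiring_1 fps"
  assumes "\<And>i. i \<le> n \<Longrightarrow> F $ i = G $ i"
  shows "(F ^ j) $ n = (G ^ j) $ n"
  using assms
proof (induction j arbitrary: n)
  case (Suc j)
  then show ?case by (auto simp: fps_mult_nth intro!: sum.cong)
qed simp

section \<open>Generating functions of forests\<close>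

definition kary_forests :: "nat \<Rightarrow> nat \<Rightarrow> nat \<Rightarrow> otree list set" where
  "kary_forests k j n =
     {ts. length ts = j \<and> (\<forall>t\<in>set ts. is_kary k t) \<and> (\<Sum>t\<leftarrow>ts. num_vertices t) = n}"

lemma finite_kary_forests: "finite (kary_forests k j n)"
proof (rule finite_subset)
  show "kary_forests k j n \<subseteq> {ts. set ts \<subseteq> (\<Union>i\<le>n. kary_trees k i) \<and> length ts = j}"
    using member_le_sum_list[of _ "map num_vertices _"]
    by (fastforce simp: kary_forests_def kary_trees_def)
  show "finite {ts. set ts \<subseteq> (\<Union>i\<le>n. kary_trees k i) \<and> length ts = j}"
    by (intro finite_lists_length_eq) (auto simp: finite_kary_trees)
qed

lemma kary_forests_Suc:
  "kary_forests k (Suc j) n =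
     (\<lambda>(i, t, ts). t # ts) ` (SIGMA i:{0..n}. kary_trees k i \<times> kary_forests k j (n - i))"
  (is "_ = _ ` ?B")
proof (intro set_eqI iffI)
  fix us assume us: "us \<in> kary_forests k (Suc j) n"
  then obtain t ts where "us = t # ts"
    by (auto simp: kary_forests_def length_Suc_conv)
  with us have "(num_vertices t, t, ts) \<in> ?B" and "us = (\<lambda>(i, t, ts). t # ts) (num_vertices t, t, ts)"
    by (auto simp: kary_forests_def kary_trees_def)
  then show "us \<in> (\<lambda>(i, t, ts). t # ts) ` ?B" by blast
qed (auto simp: kary_forests_def kary_trees_def)

text \<open>Splitting off the first tree is a Cauchy product. The length \<open>j\<close> is kept
  apart from the arity \<open>k\<close> so that induction on \<open>j\<close> is possible.\<close>

lemma sum_kary_forests: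
  fixes w :: "otree \<Rightarrow> 'a::comm_semiring_1"
  shows "(\<Sum>ts\<in>kary_forests k j n. \<Prod>t\<leftarrow>ts. w t) = (Abs_fps (\<lambda>i. \<Sum>T\<in>kary_trees k i. w T) ^ j) $ n"
proof (induction j arbitrary: n)
  case 0
  have "kary_forests k 0 n = (if n = 0 then {[]} else {})"
    by (auto simp: kary_forests_def)
  then show ?case by simp
next
  case (Suc j)
  let ?B = "SIGMA i:{0..n}. kary_trees k i \<times> kary_forests k j (n - i)"
  \<comment> \<open>The index \<open>i\<close> can be recovered from the list, being the number of
    vertices of its first tree.\<close>
  have inj: "inj_on (\<lambda>(i, t, ts). t # ts) ?B"
    by (auto simp: inj_on_def kary_trees_def)
  have "(\<Sum>ts\<in>kary_forests k (Suc j) n. \<Prod>t\<leftarrow>ts. w t) = (\<Sum>(i, t, ts)\<in>?B. w t * (\<Prod>t\<leftarrow>ts. w t))"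
    unfolding kary_forests_Suc by (subst sum.reindex[OF inj]) (auto intro: sum.cong)
  also have "\<dots> = (\<Sum>i=0..n. \<Sum>(t, ts)\<in>kary_trees k i \<times> kary_forests k j (n - i). w t * (\<Prod>t\<leftarrow>ts. w t))"
    by (subst sum.Sigma) (auto simp: finite_kary_trees finite_kary_forests)
  also have "\<dots> = (\<Sum>i=0..n. (\<Sum>t\<in>kary_trees k i. w t) * (\<Sum>ts\<in>kary_forests k j (n - i). \<Prod>t\<leftarrow>ts. w t))"
    by (simp add: sum_product sum.cartesian_product)
  finally show ?case by (simp add: Suc fps_mult_nth)
qed

section \<open>Removing the root\<close>

lemma kary_trees_0: "kary_trees k 0 = {Empty}"
proof -
  have "T \<in> kary_trees k 0 \<longleftrightarrow> T = Empty" for T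
    by (cases T) (auto simp: kary_trees_def)
  then show ?thesis by auto
qed

lemma kary_trees_Suc: "kary_trees k (Suc n) = Node ` kary_forests k k n"
proof -
  have "T \<in> kary_trees k (Suc n) \<longleftrightarrow> T \<in> Node ` kary_forests k k n" for T
    by (cases T) (auto simp: kary_trees_def kary_forests_def)
  then show ?thesis by auto
qed

lemma prod_hook_lengths_Node:
  fixes g :: "nat \<Rightarrow> 'a::comm_monoid_mult"
  shows "(\<Prod>h\<in>#hook_lengths (Node ts). g h) =
           g (num_vertices (Node ts)) * (\<Prod>t\<leftarrow>ts. \<Prod>h\<in>#hook_lengths t. g h)"
proof -
  have "(\<Prod>h\<in>#(\<Sum>t\<leftarrow>ts. hook_lengths t). g h) = (\<Prod>t\<leftarrow>ts. \<Prod>h\<in>#hook_lengths t. g h)"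
    by (induction ts) auto
  then show ?thesis by simp
qed

text \<open>The root has hook length \<open>Suc n\<close> in every tree summed over, so its factor
  can be pulled out of the sum.\<close>

lemma sum_prod_hook_lengths_Suc:
  fixes k :: nat and g :: "nat \<Rightarrow> 'a::comm_semiring_1"
  defines "S \<equiv> \<lambda>i. \<Sum>T\<in>kary_trees k i. \<Prod>h\<in>#hook_lengths T. g h"
  shows "S (Suc n) = g (Suc n) * (Abs_fps S ^ k) $ n"
proof -
  have "S (Suc n) = (\<Sum>ts\<in>kary_forests k k n. \<Prod>h\<in>#hook_lengths (Node ts). g h)"
    unfolding S_def kary_trees_Suc by (subst sum.reindex) (auto simp: inj_on_def)
  also have "\<dots> = (\<Sum>ts\<in>kary_forests k k n. g (Suc n) * (\<Prod>t\<leftarrow>ts. \<Prod>h\<in>#hook_lengths t. g h))"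
    by (intro sum.cong refl, subst prod_hook_lengths_Node) (simp add: kary_forests_def)
  also have "\<dots> = g (Suc n) * (Abs_fps S ^ k) $ n"
    by (simp add: sum_kary_forests S_def flip: sum_distrib_left)
  finally show ?thesis .
qed

lemma sum_hook_weights_eq_abel_poly:
  fixes z m :: "'a::field_char_0"
  assumes k: "k > 0" and nz: "\<And>l. of_nat k * z + m * of_nat l \<noteq> 0"
  shows "(\<Sum>T\<in>kary_trees k n. \<Prod>h\<in>#hook_lengths T.
             ((z + m * of_nat h) powi (int h - 1))
             / (of_nat k * of_nat h * (of_nat k * z + m * (of_nat h - 1)) powi (int h - 2)))
         = poly (abel_poly m n) z"
proof -
  define g where "g h = ((z + m * of_nat h) powi (int h - 1))
             / (of_nat k * of_nat h * (of_nat k * z + m * (of_nat h - 1)) powi (int h - 2))" for h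
  define S where "S i = (\<Sum>T\<in>kary_trees k i. \<Prod>h\<in>#hook_lengths T. g h)" for i
  have "S n = poly (abel_poly m n) z"
  proof (induction n rule: less_induct)
    case (less n)
    show ?case
    proof (cases n)
      case 0
      then show ?thesis by (simp add: S_def kary_trees_0)
    next
      case (Suc l)
      \<comment> \<open>This is both the base of the power in the denominator of \<open>g n\<close>
        and the base in Abel's coefficient number \<open>l\<close> at \<open>k z\<close>. Both carry
        the exponent \<open>l - 1\<close>, so the powers cancel.\<close>
      define c where "c = of_nat k * z + m * of_nat l"
      have "c \<noteq> 0"
        using nz by (simp add: c_def)
      have "(Abs_fps S ^ k) $ l = (abel_fps m z ^ k) $ l"
        by (rule fps_power_nth_cong) (use less Suc in simp)
      also have "\<dots> = poly (abel_poly m l) (of_nat k * z)"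
        by (simp add: abel_fps_power)
      \<comment> \<open>The integer exponent lets one formula cover \<open>l = 0\<close> too: there
        \<open>c = k z\<close>, and \<open>k z\<close> times its inverse is Abel's coefficient
        1.\<close>
      also have "\<dots> = of_nat k * z * c powi (int l - 1) / fact l"
      proof (cases l)
        case 0
        then show ?thesis using \<open>c \<noteq> 0\<close> by (simp add: c_def power_int_minus field_simps)
      next
        case (Suc r)
        then show ?thesis by (simp add: poly_abel_poly c_def power_int_def)
      qed
      finally have "S n = g n * (of_nat k * z * c powi (int l - 1) / fact l)"
        using sum_prod_hook_lengths_Suc[where k = k and g = g and n = l, folded S_def]
        by (simp add: Suc)
      moreover have "g n = (z + m * of_nat n) ^ l / (of_nat k * of_nat n * c powi (int l - 1))"
        by (simp add: g_def c_def Suc power_int_def)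
      moreover have "poly (abel_poly m n) z = z * (z + m * of_nat n) ^ l / (of_nat n * fact l)"
        by (simp add: poly_abel_poly Suc)
      ultimately show ?thesis using k \<open>c \<noteq> 0\<close> by simp
    qed
  qed
  then show ?thesis by (simp add: S_def g_def)
qed

section \<open>Specialisation to rational functions\<close>

lemma ratfun_z_linear_nonzero:
  assumes "a \<noteq> 0"
  shows "of_nat a * ratfun_z + of_nat b \<noteq> 0"
proof -
  have "of_nat a * ratfun_z + of_nat b = Fract [:of_nat b, of_nat a:] 1"
    by (simp add: ratfun_z_def of_nat_fract of_nat_poly)
  then show ?thesis using assms by (simp add: Zero_fract_def eq_fract)
qed

theorem theorem2p5:
  fixes k n :: nat
  assumes "k \<ge> 1" and "n \<ge> 1"
  shows "fact n * (\<Sum>T\<in>kary_trees k n. \<Prod>h\<in>#hook_lengths T.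
             ((ratfun_z + (of_nat k - 1) * of_nat h) powi (int h - 1))
             / (of_nat k * of_nat h *
                 (of_nat k * ratfun_z + (of_nat k - 1) * (of_nat h - 1)) powi (int h - 2)))
         = ratfun_z * (ratfun_z + (of_nat k - 1) * of_nat n) ^ (n - 1)"
proof -
  \<comment> \<open>As \<open>k \<ge> 1\<close>, the constant term is the natural number
    \<open>(k - 1) * l\<close>, and the coefficient \<open>k\<close> of the indeterminate is
    nonzero.\<close>
  have "of_nat k * ratfun_z + (of_nat k - 1) * of_nat l \<noteq> 0" for l
    using ratfun_z_linear_nonzero[of k "(k - 1) * l"] assms(1) by (simp add: of_nat_diff)
  then show ?thesis
    using assms by (subst sum_hook_weights_eq_abel_poly) (auto simp: poly_abel_poly)
qed

end
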